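(* Let $\mathcal{C}$ be a category and let $F:\mathcal{C}\to\mathbf{Span}(\mathbf{Set})$ be a pseudofunctor (a $\mathbf{Span}(\mathbf{Set})$-automaton). Then there is a canonical (forward) simulation from $F$ to $\mathrm{Det}(F)=R\circ\mathrm{Im}\circ F$, i.e. a lax natural transformation from $\mathrm{Det}(F)$ (regarded as landing in $\mathbf{Span}(\mathbf{Set})$ via the inclusions $\mathbf{Set}\to\mathbf{Rel}\to\mathbf{Span}(\mathbf{Set})$) to $F$, given by pasting the forward simulation $"\eta"F: i\,\mathrm{Im}\,F\Rightarrow F$ with the counit $\varepsilon$ of the Kleisli adjunction between $\mathbf{Set}$ and $\mathbf{Rel}$ (whiskered with $\mathrm{Im}\circ F$ and with the inclusion $i:\mathbf{Rel}\to\mathbf{Span}(\mathbf{Set})$).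
   Context: $\mathbf{Span}(\mathbf{Set})$ is the bicategory (2-category in the paper's terminology) whose objects are sets, whose 1-morphisms $A\to B$ are spans $A\xleftarrow{f}S\xrightarrow{g}B$ composed by pullback, and whose 2-morphisms are functions $h:S\to S'$ commuting with the legs. $\mathbf{Rel}$ is viewed as a 2-category of sets, relations and inclusions of relations. $i:\mathbf{Rel}\to\mathbf{Span}(\mathbf{Set})$ is the inclusion, sending a relation $r\subseteq A\times B$ to the span given by its two projections (its comparison cells for composition are the span morphisms $i(s)\circ i(r)\to i(s\circ r)$). $\mathrm{Im}:\mathbf{Span}(\mathbf{Set})\to\mathbf{Rel}$ is the identity on objects and sends a span $A\xleftarrow{f}S\xrightarrow{g}B$ to the relation $\{(f(s),g(s))\mid s\in S\}$. For sets $A,B$ there is an adjunction $\mathrm{Im}:\mathbf{Span}(\mathbf{Set})(A,B)\rightleftarrows\mathbf{Rel}(A,B):i$ with $\mathrm{Im}$ left adjoint; write $\eta$ for its unit. $"\eta": i\,\mathrm{Im}\Rightarrow \mathrm{Id}_{\mathbf{Span}(\mathbf{Set})}$ is the lax natural transformation whose components are identities and whose lax naturality 2-cell at a span $w:c\to d$ is $\eta_w: w\Rightarrow i(\mathrm{Im}(w))$. $R:\mathbf{Rel}\to\mathbf{Set}$ sends $A$ to $\mathcal{P}(A)$ and $r\subseteq A\times B$ to the function $S\mapsto\{b\mid\exists a\in S,(a,b)\in r\}$. It is right adjoint to the inclusion $\mathbf{Set}\to\mathbf{Rel}$, and the counit $\varepsilon$ of this Kleisli adjunction (of the powerset monad)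 has components the relations $\varepsilon_A=\{(S,a)\mid a\in S\}\subseteq\mathcal{P}(A)\times A$. The determinization of $F$ is $\mathrm{Det}(F):=R\circ\mathrm{Im}\circ F:\mathcal{C}\to\mathbf{Set}$, which is a strict functor. Convention: a lax natural transformation $\alpha:F'\Rightarrow F$ has 1-cell components $\alpha_c:F'(c)\to F(c)$ and, for each $w:c\to d$, a 2-cell $F(w)\circ\alpha_c\Rightarrow\alpha_d\circ F'(w)$, subject to the usual coherence. A (forward) simulation from $F$ to $F'$ is a lax natural transformation $\alpha:F'\Rightarrow F$. *)

theory Defs
  imports "HOL-Library.FuncSet"
begin

text \<open>
  The powerset of a set and the apex of a pullback live in other types than the sets they are
  built from.  So the objects of Span(Set), Rel and Set are taken to be sets over arbitrary
  types, and the operations of these (2-)categories are polymorphic functions.  All 2-cells,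
  and all arrows of Set, are HOL functions of which only the values on the domain matter;
  equality between them is agreement on the domain.
\<close>

definition agree_on :: "'x set \<Rightarrow> ('x \<Rightarrow> 'y) \<Rightarrow> ('x \<Rightarrow> 'y) \<Rightarrow> bool" where
  "agree_on A h k \<longleftrightarrow> (\<forall>x\<in>A. h x = k x)"


section \<open>Categories\<close>

record ('o, 'm) cat =
  Ob :: "'o set"
  Ar :: "'m set"
  src :: "'m \<Rightarrow> 'o"
  tgt :: "'m \<Rightarrow> 'o"
  idn :: "'o \<Rightarrow> 'm"
  cmp :: "'m \<Rightarrow> 'm \<Rightarrow> 'm"

text \<open>\<open>cmp C g f\<close> is the composite of \<open>f\<close> followed by \<open>g\<close>.\<close>

locale category =
  fixes C :: "('o, 'm) cat"
  assumes src_in: "f \<in> Ar C \<Longrightarrow> src C f \<in> Ob C"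
    and tgt_in: "f \<in> Ar C \<Longrightarrow> tgt C f \<in> Ob C"
    and idn_in: "c \<in> Ob C \<Longrightarrow> idn C c \<in> Ar C"
    and src_idn: "c \<in> Ob C \<Longrightarrow> src C (idn C c) = c"
    and tgt_idn: "c \<in> Ob C \<Longrightarrow> tgt C (idn C c) = c"
    and cmp_in: "\<lbrakk>f \<in> Ar C; g \<in> Ar C; tgt C f = src C g\<rbrakk> \<Longrightarrow> cmp C g f \<in> Ar C"
    and src_cmp: "\<lbrakk>f \<in> Ar C; g \<in> Ar C; tgt C f = src C g\<rbrakk> \<Longrightarrow> src C (cmp C g f) = src C f"
    and tgt_cmp: "\<lbrakk>f \<in> Ar C; g \<in> Ar C; tgt C f = src C g\<rbrakk> \<Longrightarrow> tgt C (cmp C g f) = tgt C g"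
    and cmp_idn_left: "f \<in> Ar C \<Longrightarrow> cmp C (idn C (tgt C f)) f = f"
    and cmp_idn_right: "f \<in> Ar C \<Longrightarrow> cmp C f (idn C (src C f)) = f"
    and cmp_assoc: "\<lbrakk>f \<in> Ar C; g \<in> Ar C; h \<in> Ar C; tgt C f = src C g; tgt C g = src C h\<rbrakk>
      \<Longrightarrow> cmp C h (cmp C g f) = cmp C (cmp C h g) f"


section \<open>The bicategory of spans\<close>

record ('a, 'b, 's) span =
  apex :: "'s set"
  lleg :: "'s \<Rightarrow> 'a"
  rleg :: "'s \<Rightarrow> 'b"

definition is_span :: "'a set \<Rightarrow> 'b set \<Rightarrow> ('a, 'b, 's) span \<Rightarrow> bool" where
  "is_span A B S \<longleftrightarrow> lleg S \<in> apex S \<rightarrow> A \<and> rleg S \<in> apex S \<rightarrow> B"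

definition id_span :: "'a set \<Rightarrow> ('a, 'a, 'a) span" where
  "id_span A = \<lparr>apex = A, lleg = (\<lambda>a. a), rleg = (\<lambda>a. a)\<rparr>"

definition span_comp :: "('b, 'c, 't) span \<Rightarrow> ('a, 'b, 's) span \<Rightarrow> ('a, 'c, 's \<times> 't) span"
    (infixr "\<odot>" 75) where
  "T \<odot> S = \<lparr>apex = {(s, t). s \<in> apex S \<and> t \<in> apex T \<and> rleg S s = lleg T t},
            lleg = (\<lambda>(s, t). lleg S s), rleg = (\<lambda>(s, t). rleg T t)\<rparr>"

definition cell2 :: "('a, 'b, 's) span \<Rightarrow> ('a, 'b, 't) span \<Rightarrow> ('s \<Rightarrow> 't) \<Rightarrow> bool" where
  "cell2 S T h \<longleftrightarrow> h \<in> apex S \<rightarrow> apex T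
     \<and> (\<forall>s\<in>apex S. lleg T (h s) = lleg S s \<and> rleg T (h s) = rleg S s)"

definition inverse_cells ::
    "('a, 'b, 's) span \<Rightarrow> ('a, 'b, 't) span \<Rightarrow> ('s \<Rightarrow> 't) \<Rightarrow> ('t \<Rightarrow> 's) \<Rightarrow> bool" where
  "inverse_cells S T h k \<longleftrightarrow> cell2 S T h \<and> cell2 T S k
     \<and> agree_on (apex S) (k \<circ> h) id \<and> agree_on (apex T) (h \<circ> k) id"

definition iso_cell2 :: "('a, 'b, 's) span \<Rightarrow> ('a, 'b, 't) span \<Rightarrow> ('s \<Rightarrow> 't) \<Rightarrow> bool" where
  "iso_cell2 S T h \<longleftrightarrow> (\<exists>k. inverse_cells S T h k)"

text \<open>
  Vertical composition of 2-cells is \<open>\<circ>\<close> and identity 2-cells are \<open>id\<close>.  Horizontal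
  composition sends \<open>k : T \<Rightarrow> T'\<close> and \<open>h : S \<Rightarrow> S'\<close> to \<open>k \<star> h : T \<odot> S \<Rightarrow> T' \<odot> S'\<close>.
\<close>

definition hcomp :: "('t \<Rightarrow> 'u) \<Rightarrow> ('s \<Rightarrow> 'v) \<Rightarrow> 's \<times> 't \<Rightarrow> 'v \<times> 'u" (infixr "\<star>" 76) where
  "k \<star> h = (\<lambda>(s, t). (h s, k t))"

text \<open>\<open>assoc : (U \<odot> T) \<odot> S \<Rightarrow> U \<odot> (T \<odot> S)\<close> and its inverse.\<close>

definition assoc :: "'s \<times> ('t \<times> 'u) \<Rightarrow> ('s \<times> 't) \<times> 'u" where
  "assoc = (\<lambda>(s, (t, u)). ((s, t), u))"

definition assoc_inv :: "('s \<times> 't) \<times> 'u \<Rightarrow> 's \<times> ('t \<times> 'u)" where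
  "assoc_inv = (\<lambda>((s, t), u). (s, (t, u)))"

text \<open>\<open>lunit : id_span B \<odot> S \<Rightarrow> S\<close> and \<open>runit : S \<odot> id_span A \<Rightarrow> S\<close>, and their inverses.\<close>

definition lunit :: "'s \<times> 'b \<Rightarrow> 's" where
  "lunit = (\<lambda>(s, b). s)"

definition lunit_inv :: "('a, 'b, 's) span \<Rightarrow> 's \<Rightarrow> 's \<times> 'b" where
  "lunit_inv S = (\<lambda>s. (s, rleg S s))"

definition runit :: "'a \<times> 's \<Rightarrow> 's" where
  "runit = (\<lambda>(a, s). s)"

definition runit_inv :: "('a, 'b, 's) span \<Rightarrow> 's \<Rightarrow> 'a \<times> 's" where
  "runit_inv S = (\<lambda>s. (lleg S s, s))"

lemma assoc_inverse_cells:
  "inverse_cells ((U \<odot> T) \<odot> S) (U \<odot> (T \<odot> S)) assoc assoc_inv"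
  by (auto simp: inverse_cells_def cell2_def agree_on_def span_comp_def assoc_def assoc_inv_def)

lemma lunit_inverse_cells:
  "is_span A B S \<Longrightarrow> inverse_cells (id_span B \<odot> S) S lunit (lunit_inv S)"
  by (auto simp: inverse_cells_def cell2_def agree_on_def span_comp_def id_span_def is_span_def
      lunit_def lunit_inv_def)

lemma runit_inverse_cells:
  "is_span A B S \<Longrightarrow> inverse_cells (S \<odot> id_span A) S runit (runit_inv S)"
  by (auto simp: inverse_cells_def cell2_def agree_on_def span_comp_def id_span_def is_span_def
      runit_def runit_inv_def)


section \<open>Lax functors and lax natural transformations into Span(Set)\<close>

text \<open>
  For \<open>F : C \<rightarrow> Span(Set)\<close>, \<open>fcmp F g f : F g \<odot> F f \<Rightarrow> F (g f)\<close> and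
  \<open>funit F c : id_span (F c) \<Rightarrow> F (idn c)\<close> are the comparison cells.  As \<open>C\<close> has only identity
  2-cells, functoriality on 2-cells and naturality of the comparison cells are vacuous.
\<close>

record ('o, 'm, 'a, 's) span_functor =
  fobj :: "'o \<Rightarrow> 'a set"
  farr :: "'m \<Rightarrow> ('a, 'a, 's) span"
  fcmp :: "'m \<Rightarrow> 'm \<Rightarrow> 's \<times> 's \<Rightarrow> 's"
  funit :: "'o \<Rightarrow> 'a \<Rightarrow> 's"

definition lax_functor :: "('o, 'm) cat \<Rightarrow> ('o, 'm, 'a, 's) span_functor \<Rightarrow> bool" where
  "lax_functor C F \<longleftrightarrow>
     (\<forall>f\<in>Ar C. is_span (fobj F (src C f)) (fobj F (tgt C f)) (farr F f)) \<and>
     (\<forall>f\<in>Ar C. \<forall>g\<in>Ar C. tgt C f = src C g \<longrightarrow>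
        cell2 (farr F g \<odot> farr F f) (farr F (cmp C g f)) (fcmp F g f)) \<and>
     (\<forall>c\<in>Ob C. cell2 (id_span (fobj F c)) (farr F (idn C c)) (funit F c)) \<and>
     (\<forall>f\<in>Ar C. \<forall>g\<in>Ar C. \<forall>h\<in>Ar C. tgt C f = src C g \<longrightarrow> tgt C g = src C h \<longrightarrow>
        agree_on (apex ((farr F h \<odot> farr F g) \<odot> farr F f))
          (fcmp F h (cmp C g f) \<circ> (id \<star> fcmp F g f) \<circ> assoc)
          (fcmp F (cmp C h g) f \<circ> (fcmp F h g \<star> id))) \<and>
     (\<forall>f\<in>Ar C. agree_on (apex (id_span (fobj F (tgt C f)) \<odot> farr F f))
        (fcmp F (idn C (tgt C f)) f \<circ> (funit F (tgt C f) \<star> id)) lunit) \<and>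
     (\<forall>f\<in>Ar C. agree_on (apex (farr F f \<odot> id_span (fobj F (src C f))))
        (fcmp F f (idn C (src C f)) \<circ> (id \<star> funit F (src C f))) runit)"

definition pseudofunctor :: "('o, 'm) cat \<Rightarrow> ('o, 'm, 'a, 's) span_functor \<Rightarrow> bool" where
  "pseudofunctor C F \<longleftrightarrow> lax_functor C F \<and>
     (\<forall>f\<in>Ar C. \<forall>g\<in>Ar C. tgt C f = src C g \<longrightarrow>
        iso_cell2 (farr F g \<odot> farr F f) (farr F (cmp C g f)) (fcmp F g f)) \<and>
     (\<forall>c\<in>Ob C. iso_cell2 (id_span (fobj F c)) (farr F (idn C c)) (funit F c))"

record ('o, 'm, 'a, 'b, 'k, 's, 't) lax_trans =
  comp1 :: "'o \<Rightarrow> ('a, 'b, 'k) span"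
  cell :: "'m \<Rightarrow> 'k \<times> 't \<Rightarrow> 's \<times> 'k"

text \<open>
  \<open>lax_transformation C G F \<alpha>\<close>: \<open>\<alpha> : G \<Rightarrow> F\<close> is lax natural, with 1-cells \<open>\<alpha>\<^sub>c : G c \<rightarrow> F c\<close> and
  2-cells \<open>F w \<odot> \<alpha>\<^sub>c \<Rightarrow> \<alpha>\<^sub>d \<odot> G w\<close> for \<open>w : c \<rightarrow> d\<close>.  The last two clauses are lax unity and
  lax naturality.
\<close>

definition lax_transformation ::
    "('o, 'm) cat \<Rightarrow> ('o, 'm, 'a, 's) span_functor \<Rightarrow> ('o, 'm, 'b, 't) span_functor
      \<Rightarrow> ('o, 'm, 'a, 'b, 'k, 's, 't) lax_trans \<Rightarrow> bool" where
  "lax_transformation C G F \<alpha> \<longleftrightarrow>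
     lax_functor C G \<and> lax_functor C F \<and>
     (\<forall>c\<in>Ob C. is_span (fobj G c) (fobj F c) (comp1 \<alpha> c)) \<and>
     (\<forall>w\<in>Ar C. cell2 (farr F w \<odot> comp1 \<alpha> (src C w)) (comp1 \<alpha> (tgt C w) \<odot> farr G w) (cell \<alpha> w)) \<and>
     (\<forall>c\<in>Ob C. agree_on (apex (id_span (fobj F c) \<odot> comp1 \<alpha> c))
        (cell \<alpha> (idn C c) \<circ> (funit F c \<star> id))
        ((id \<star> funit G c) \<circ> runit_inv (comp1 \<alpha> c) \<circ> lunit)) \<and>
     (\<forall>f\<in>Ar C. \<forall>g\<in>Ar C. tgt C f = src C g \<longrightarrow>
        agree_on (apex ((farr F g \<odot> farr F f) \<odot> comp1 \<alpha> (src C f)))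
          (cell \<alpha> (cmp C g f) \<circ> (fcmp F g f \<star> id))
          ((id \<star> fcmp G g f) \<circ> assoc \<circ> (cell \<alpha> g \<star> id) \<circ> assoc_inv \<circ> (id \<star> cell \<alpha> f) \<circ> assoc))"

text \<open>A forward simulation from \<open>F\<close> to \<open>F'\<close> is a lax natural transformation \<open>F' \<Rightarrow> F\<close>.\<close>

definition simulation ::
    "('o, 'm) cat \<Rightarrow> ('o, 'm, 'b, 't) span_functor \<Rightarrow> ('o, 'm, 'a, 's) span_functor
      \<Rightarrow> ('o, 'm, 'a, 'b, 'k, 's, 't) lax_trans \<Rightarrow> bool" where
  "simulation C F F' \<alpha> \<longleftrightarrow> lax_transformation C F' F \<alpha>"

text \<open>
  Pasting of \<open>\<alpha> : G \<Rightarrow> H\<close> and \<open>\<beta> : H \<Rightarrow> F\<close>: the 1-cells are \<open>\<beta>\<^sub>c \<odot> \<alpha>\<^sub>c\<close>, and the 2-cell at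
  \<open>w : c \<rightarrow> d\<close> pastes \<open>F w \<odot> \<beta>\<^sub>c \<Rightarrow> \<beta>\<^sub>d \<odot> H w\<close> with \<open>H w \<odot> \<alpha>\<^sub>c \<Rightarrow> \<alpha>\<^sub>d \<odot> G w\<close>.
\<close>

definition paste ::
    "('o, 'm, 'b, 'c, 'l, 'h, 't) lax_trans \<Rightarrow> ('o, 'm, 'a, 'b, 'k, 's, 'h) lax_trans
      \<Rightarrow> ('o, 'm, 'a, 'c, 'k \<times> 'l, 's, 't) lax_trans" where
  "paste \<beta> \<alpha> = \<lparr>comp1 = (\<lambda>c. comp1 \<beta> c \<odot> comp1 \<alpha> c),
     cell = (\<lambda>w. assoc_inv \<circ> (id \<star> cell \<alpha> w) \<circ> assoc \<circ> (cell \<beta> w \<star> id) \<circ> assoc_inv)\<rparr>"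


section \<open>Rel, Set and the functors between them\<close>

text \<open>A relation is a set of pairs, and the composite of \<open>r\<close> followed by \<open>s\<close> is \<open>r O s\<close>.\<close>

record ('o, 'm, 'a) rel_functor =
  robj :: "'o \<Rightarrow> 'a set"
  rarr :: "'m \<Rightarrow> ('a \<times> 'a) set"

record ('o, 'm, 'a) set_functor =
  sobj :: "'o \<Rightarrow> 'a set"
  sarr :: "'m \<Rightarrow> 'a \<Rightarrow> 'a"

definition is_set_functor :: "('o, 'm) cat \<Rightarrow> ('o, 'm, 'a) set_functor \<Rightarrow> bool" where
  "is_set_functor C D \<longleftrightarrow>
     (\<forall>f\<in>Ar C. sarr D f \<in> sobj D (src C f) \<rightarrow> sobj D (tgt C f)) \<and>
     (\<forall>c\<in>Ob C. agree_on (sobj D c) (sarr D (idn C c)) id) \<and>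
     (\<forall>f\<in>Ar C. \<forall>g\<in>Ar C. tgt C f = src C g \<longrightarrow>
        agree_on (sobj D (src C f)) (sarr D (cmp C g f)) (sarr D g \<circ> sarr D f))"

definition Im :: "('a, 'b, 's) span \<Rightarrow> ('a \<times> 'b) set" where
  "Im S = {(lleg S s, rleg S s) | s. s \<in> apex S}"

definition incl :: "('a \<times> 'b) set \<Rightarrow> ('a, 'b, 'a \<times> 'b) span" where
  "incl r = \<lparr>apex = r, lleg = fst, rleg = snd\<rparr>"

text \<open>The comparison cells \<open>incl s \<odot> incl r \<Rightarrow> incl (r O s)\<close> and \<open>id_span A \<Rightarrow> incl (Id_on A)\<close>.\<close>

definition incl_comp :: "('a \<times> 'b) \<times> ('b \<times> 'c) \<Rightarrow> 'a \<times> 'c" where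
  "incl_comp = (\<lambda>((a, b), (b', c)). (a, c))"

definition incl_unit :: "'a \<Rightarrow> 'a \<times> 'a" where
  "incl_unit = (\<lambda>a. (a, a))"

definition graph :: "'a set \<Rightarrow> ('a \<Rightarrow> 'b) \<Rightarrow> ('a \<times> 'b) set" where
  "graph A f = {(a, f a) | a. a \<in> A}"

definition R_arr :: "('a \<times> 'b) set \<Rightarrow> 'a set \<Rightarrow> 'b set" where
  "R_arr r = (\<lambda>S. {b. \<exists>a\<in>S. (a, b) \<in> r})"

text \<open>
  Postcomposition with \<open>Im : Span(Set) \<rightarrow> Rel\<close>, with \<open>R : Rel \<rightarrow> Set\<close>, and with the inclusions
  \<open>Set \<rightarrow> Rel\<close> and \<open>i : Rel \<rightarrow> Span(Set)\<close>.
\<close>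

definition Im_after :: "('o, 'm, 'a, 's) span_functor \<Rightarrow> ('o, 'm, 'a) rel_functor" where
  "Im_after F = \<lparr>robj = fobj F, rarr = (\<lambda>f. Im (farr F f))\<rparr>"

definition R_after :: "('o, 'm, 'a) rel_functor \<Rightarrow> ('o, 'm, 'a set) set_functor" where
  "R_after G = \<lparr>sobj = (\<lambda>c. Pow (robj G c)), sarr = (\<lambda>f. R_arr (rarr G f))\<rparr>"

definition J_after :: "('o, 'm) cat \<Rightarrow> ('o, 'm, 'a) set_functor \<Rightarrow> ('o, 'm, 'a) rel_functor" where
  "J_after C D = \<lparr>robj = sobj D, rarr = (\<lambda>f. graph (sobj D (src C f)) (sarr D f))\<rparr>"

definition incl_after :: "('o, 'm, 'a) rel_functor \<Rightarrow> ('o, 'm, 'a, 'a \<times> 'a) span_functor" where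
  "incl_after G = \<lparr>fobj = robj G, farr = (\<lambda>f. incl (rarr G f)),
     fcmp = (\<lambda>g f. incl_comp), funit = (\<lambda>c. incl_unit)\<rparr>"

definition Det :: "('o, 'm, 'a, 's) span_functor \<Rightarrow> ('o, 'm, 'a set) set_functor" where
  "Det F = R_after (Im_after F)"


section \<open>The transformations to be pasted\<close>

text \<open>The unit \<open>S \<Rightarrow> incl (Im S)\<close> of the adjunction between \<open>Im\<close> and \<open>i\<close> on hom-categories.\<close>

definition eta :: "('a, 'b, 's) span \<Rightarrow> 's \<Rightarrow> 'a \<times> 'b" where
  "eta S = (\<lambda>s. (lleg S s, rleg S s))"

lemma eta_universal:
  "cell2 S (incl (Im S)) (eta S)"
  "cell2 S (incl r) h \<Longrightarrow> Im S \<subseteq> r \<and> agree_on (apex S) h (id \<circ> eta S)"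
  by (auto simp: cell2_def incl_def Im_def eta_def agree_on_def prod_eq_iff)
     (metis prod.collapse funcset_mem)

text \<open>
  The transformation \<open>i Im \<Rightarrow> Id\<close> on Span(Set), whiskered with \<open>F\<close>.  Its 1-cells are identities,
  so that up to unitors its 2-cell at \<open>w\<close> is the unit at the span \<open>F w\<close>.
\<close>

definition eta_whisker ::
    "('o, 'm, 'a, 's) span_functor \<Rightarrow> ('o, 'm, 'a, 'a, 'a, 'a \<times> 'a, 's) lax_trans" where
  "eta_whisker F = \<lparr>comp1 = (\<lambda>c. id_span (fobj F c)),
     cell = (\<lambda>w. lunit_inv (incl (Im (farr F w))) \<circ> eta (farr F w) \<circ> runit)\<rparr>"

definition eps :: "'a set \<Rightarrow> ('a set \<times> 'a) set" where
  "eps A = {(S, a). S \<in> Pow A \<and> a \<in> S}"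

lemma eps_natural:
  "r \<subseteq> A \<times> B \<Longrightarrow> eps A O r = graph (Pow A) (R_arr r) O eps B"
  by (auto simp: eps_def graph_def R_arr_def relcomp_unfold)

text \<open>
  \<open>i\<close> is only lax, so whiskering with it yields a 2-cell by way of an inverse comparison cell:
  for \<open>r : A \<rightarrow> B\<close> in Rel, naturality of the counit gives
  \<open>i r \<odot> i \<epsilon>\<^sub>A \<Rightarrow> i (r \<epsilon>\<^sub>A) = i (\<epsilon>\<^sub>B R(r)) \<Rightarrow> i \<epsilon>\<^sub>B \<odot> i R(r)\<close>,
  where the comparison cell that is inverted is invertible since \<open>R(r)\<close> is a function.
\<close>

definition incl_comp_inv ::
    "('b \<times> 'c) set \<Rightarrow> ('a \<times> 'b) set \<Rightarrow> 'a \<times> 'c \<Rightarrow> ('a \<times> 'b) \<times> ('b \<times> 'c)" where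
  "incl_comp_inv s r = inv_into (apex (incl s \<odot> incl r)) incl_comp"

lemma incl_comp_inverse_cells:
  "inverse_cells (incl s \<odot> incl (graph A f)) (incl (graph A f O s)) incl_comp
     (incl_comp_inv s (graph A f))"
proof -
  have inj: "inj_on incl_comp (apex (incl s \<odot> incl (graph A f)))"
    by (auto simp: inj_on_def incl_comp_def span_comp_def incl_def graph_def)
  have im: "incl_comp ` apex (incl s \<odot> incl (graph A f)) = graph A f O s"
    by (force simp: incl_comp_def span_comp_def incl_def graph_def relcomp_unfold image_iff)
  have fwd: "cell2 (incl s \<odot> incl (graph A f)) (incl (graph A f O s)) incl_comp"
    by (auto simp: cell2_def incl_comp_def span_comp_def incl_def)
  have "agree_on (apex (incl s \<odot> incl (graph A f))) (incl_comp_inv s (graph A f) \<circ> incl_comp) id"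
    using inj by (simp add: agree_on_def incl_comp_inv_def)
  moreover have r: "incl_comp (incl_comp_inv s (graph A f) x) = x"
      "incl_comp_inv s (graph A f) x \<in> apex (incl s \<odot> incl (graph A f))"
    if "x \<in> graph A f O s" for x
    using that im unfolding incl_comp_inv_def by (simp_all add: f_inv_into_f inv_into_into)
  moreover have "cell2 (incl (graph A f O s)) (incl s \<odot> incl (graph A f))
      (incl_comp_inv s (graph A f))"
    using r fwd unfolding cell2_def by (metis Pi_I incl_def span.select_convs(1))
  ultimately show ?thesis
    using fwd by (simp add: inverse_cells_def agree_on_def incl_def)
qed

definition eps_whisker ::
    "('o, 'm) cat \<Rightarrow> ('o, 'm, 'a) rel_functor
      \<Rightarrow> ('o, 'm, 'a set, 'a, 'a set \<times> 'a, 'a set \<times> 'a set, 'a \<times> 'a) lax_trans" where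
  "eps_whisker C G = \<lparr>comp1 = (\<lambda>c. incl (eps (robj G c))),
     cell = (\<lambda>w. incl_comp_inv (eps (robj G (tgt C w)))
                    (graph (Pow (robj G (src C w))) (R_arr (rarr G w))) \<circ> incl_comp)\<rparr>"

end

theory Submission
  imports Defs
begin

text \<open>
  A span whose legs are jointly injective receives at most one 2-cell from any other span.  Spans
  of relations are of this kind, and so is each span \<open>\<alpha>\<^sub>d \<odot> G w\<close> in which a naturality 2-cell of one
  of the three transformations ends, because \<open>R(Im(F w))\<close> is a function and identity spans do not
  affect the legs.  Hence every coherence equation holds as soon as both sides are 2-cells, and it
  only remains to check that the 2-cells exist and that \<open>Im\<close> preserves composition and identities
  of \<open>F\<close>, which uses the inverses of the comparison cells.
\<close>

section \<open>Two-cells of Span(Set) and the operations on them\<close>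

lemma cell2_id: "cell2 S S id"
  by (simp add: cell2_def)

lemma cell2_comp: "cell2 T U k \<Longrightarrow> cell2 S T h \<Longrightarrow> cell2 S U (k \<circ> h)"
  by (fastforce simp: cell2_def Pi_iff)

lemma cell2_hcomp: "cell2 T T' k \<Longrightarrow> cell2 S S' h \<Longrightarrow> cell2 (T \<odot> S) (T' \<odot> S') (k \<star> h)"
  by (fastforce simp: cell2_def span_comp_def hcomp_def Pi_iff)

lemma cell2_assoc: "cell2 ((U \<odot> T) \<odot> S) (U \<odot> (T \<odot> S)) assoc"
  and cell2_assoc_inv: "cell2 (U \<odot> (T \<odot> S)) ((U \<odot> T) \<odot> S) assoc_inv"
  using assoc_inverse_cells unfolding inverse_cells_def by blast+

lemma cell2_lunit: "is_span A B S \<Longrightarrow> cell2 (id_span B \<odot> S) S lunit"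
  and cell2_lunit_inv: "is_span A B S \<Longrightarrow> cell2 S (id_span B \<odot> S) (lunit_inv S)"
  using lunit_inverse_cells unfolding inverse_cells_def by blast+

lemma cell2_runit: "is_span A B S \<Longrightarrow> cell2 (S \<odot> id_span A) S runit"
  and cell2_runit_inv: "is_span A B S \<Longrightarrow> cell2 S (S \<odot> id_span A) (runit_inv S)"
  using runit_inverse_cells unfolding inverse_cells_def by blast+

lemma cell2_incl_comp: "cell2 (incl s \<odot> incl r) (incl (r O s)) incl_comp"
  by (auto simp: cell2_def incl_comp_def span_comp_def incl_def)

lemma is_span_span_comp: "is_span B D T \<Longrightarrow> is_span A B S \<Longrightarrow> is_span A D (T \<odot> S)"
  by (auto simp: is_span_def span_comp_def Pi_iff)

lemma is_span_id_span: "is_span A A (id_span A)"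
  by (simp add: is_span_def id_span_def)

lemma is_span_incl: "r \<subseteq> A \<times> B \<Longrightarrow> is_span A B (incl r)"
  by (auto simp: is_span_def incl_def)

lemma is_span_Im: "is_span A B S \<Longrightarrow> Im S \<subseteq> A \<times> B"
  by (auto simp: is_span_def Im_def)

section \<open>Jointly monic spans\<close>

text \<open>Equivalently, \<open>eta S\<close> is an isomorphism from \<open>S\<close> to
  \<open>incl (Im S)\<close>: these spans are the relations up to isomorphism.\<close>

definition jointly_monic :: "('a, 'b, 's) span \<Rightarrow> bool" where
  "jointly_monic S \<longleftrightarrow> inj_on (\<lambda>s. (lleg S s, rleg S s)) (apex S)"

text \<open>Both maps preserve the legs, so at each point of \<open>S\<close> their values have the
  same pair of legs in \<open>T\<close>.\<close>

lemma cell2_agree_on: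
  assumes "jointly_monic T" "cell2 S T h" "cell2 S T k"
  shows "agree_on (apex S) h k"
  using assms unfolding jointly_monic_def cell2_def agree_on_def inj_on_def Pi_iff by simp

lemma jointly_monic_incl: "jointly_monic (incl r)"
  by (auto simp: jointly_monic_def incl_def inj_on_def)

text \<open>A point of the pullback is \<open>((a, f a), s)\<close> with \<open>f a\<close> the left
  leg of \<open>s\<close>. The outer left leg gives \<open>a\<close>, hence the middle element
  \<open>f a\<close>, and then the outer right leg determines \<open>s\<close>. For a relation that
  is not single-valued the middle element could vary while the outer legs stay fixed.\<close>

lemma jointly_monic_comp_graph:
  assumes "jointly_monic S"
  shows "jointly_monic (S \<odot> incl (graph A f))"
  using assms by (auto simp: jointly_monic_def inj_on_def span_comp_def incl_def graph_def)

lemma jointly_monic_id_span_comp: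
  assumes "jointly_monic S"
  shows "jointly_monic (id_span A \<odot> S)"
  using assms by (auto simp: jointly_monic_def inj_on_def span_comp_def id_span_def)

section \<open>Coherence from joint monicity\<close>

text \<open>Serves the functors that factor through \<open>incl\<close>. The associativity and unit
  axioms are equations between parallel 2-cells into a span of the form \<open>farr F f\<close>, so
  monicity of these spans settles them.\<close>

lemma lax_functorI:
  assumes "category C"
    and span: "\<And>f. f \<in> Ar C \<Longrightarrow> is_span (fobj F (src C f)) (fobj F (tgt C f)) (farr F f)"
    and comp: "\<And>f g. \<lbrakk>f \<in> Ar C; g \<in> Ar C; tgt C f = src C g\<rbrakk>
      \<Longrightarrow> cell2 (farr F g \<odot> farr F f) (farr F (cmp C g f)) (fcmp F g f)"
    and unit: "\<And>c. c \<in> Ob C \<Longrightarrow> cell2 (id_span (fobj F c)) (farr F (idn C c)) (funit F c)"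
    and mono: "\<And>f. f \<in> Ar C \<Longrightarrow> jointly_monic (farr F f)"
  shows "lax_functor C F"
proof -
  interpret category C by fact
  have "agree_on (apex ((farr F h \<odot> farr F g) \<odot> farr F f))
      (fcmp F h (cmp C g f) \<circ> (id \<star> fcmp F g f) \<circ> assoc)
      (fcmp F (cmp C h g) f \<circ> (fcmp F h g \<star> id))"
    if "f \<in> Ar C" "g \<in> Ar C" "h \<in> Ar C" "tgt C f = src C g" "tgt C g = src C h" for f g h
  proof (rule cell2_agree_on)
    show "jointly_monic (farr F (cmp C h (cmp C g f)))"
      using that by (simp add: mono cmp_in tgt_cmp)
    show "cell2 ((farr F h \<odot> farr F g) \<odot> farr F f) (farr F (cmp C h (cmp C g f)))
        (fcmp F h (cmp C g f) \<circ> (id \<star> fcmp F g f) \<circ> assoc)"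
      by (rule cell2_comp[OF cell2_comp[OF comp cell2_hcomp[OF cell2_id comp]] cell2_assoc])
        (use that in \<open>simp_all add: cmp_in tgt_cmp\<close>)
    show "cell2 ((farr F h \<odot> farr F g) \<odot> farr F f) (farr F (cmp C h (cmp C g f)))
        (fcmp F (cmp C h g) f \<circ> (fcmp F h g \<star> id))"
      \<comment> \<open>This side naturally ends in the image of (h g) f; associativity in
        \<open>C\<close> identifies it with the target of the other side.\<close>
      unfolding cmp_assoc[OF that]
      by (rule cell2_comp[OF comp cell2_hcomp[OF comp cell2_id]])
        (use that in \<open>simp_all add: cmp_in src_cmp\<close>)
  qed
  moreover have "agree_on (apex (id_span (fobj F (tgt C f)) \<odot> farr F f))
      (fcmp F (idn C (tgt C f)) f \<circ> (funit F (tgt C f) \<star> id)) lunit" if f: "f \<in> Ar C" for f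
  proof (rule cell2_agree_on[OF mono[OF f]])
    show "cell2 (id_span (fobj F (tgt C f)) \<odot> farr F f) (farr F f) lunit"
      using cell2_lunit span f by blast
    \<comment> \<open>The unit law of \<open>C\<close> makes the comparison cell end in
      \<open>farr F f\<close> itself, the target of \<open>lunit\<close>.\<close>
    have "cell2 (farr F (idn C (tgt C f)) \<odot> farr F f) (farr F f) (fcmp F (idn C (tgt C f)) f)"
      using comp[of f "idn C (tgt C f)"] f by (simp add: idn_in src_idn tgt_in cmp_idn_left)
    then show "cell2 (id_span (fobj F (tgt C f)) \<odot> farr F f) (farr F f)
        (fcmp F (idn C (tgt C f)) f \<circ> (funit F (tgt C f) \<star> id))"
      using f by (blast intro: cell2_comp cell2_hcomp cell2_id unit tgt_in)
  qed
  moreover have "agree_on (apex (farr F f \<odot> id_span (fobj F (src C f))))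
      (fcmp F f (idn C (src C f)) \<circ> (id \<star> funit F (src C f))) runit" if f: "f \<in> Ar C" for f
  proof (rule cell2_agree_on[OF mono[OF f]])
    show "cell2 (farr F f \<odot> id_span (fobj F (src C f))) (farr F f) runit"
      using cell2_runit span f by blast
    have "cell2 (farr F f \<odot> farr F (idn C (src C f))) (farr F f) (fcmp F f (idn C (src C f)))"
      using comp[of "idn C (src C f)" f] f by (simp add: idn_in tgt_idn src_in cmp_idn_right)
    then show "cell2 (farr F f \<odot> id_span (fobj F (src C f))) (farr F f)
        (fcmp F f (idn C (src C f)) \<circ> (id \<star> funit F (src C f)))"
      using f by (blast intro: cell2_comp cell2_hcomp cell2_id unit src_in)
  qed
  ultimately show ?thesis
    unfolding lax_functor_def using span comp unit by blast
qed

text \<open>Monicity is asked of the targets of the naturality cells rather than of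
  \<open>F w\<close>, which may be an arbitrary span. Lax unity is an equation between cells into
  the target at an identity arrow, and lax naturality between cells into the target at a composite
  arrow.\<close>

lemma lax_transformationI:
  assumes "category C" and G: "lax_functor C G" and F: "lax_functor C F"
    and span: "\<And>c. c \<in> Ob C \<Longrightarrow> is_span (fobj G c) (fobj F c) (comp1 \<alpha> c)"
    and cell: "\<And>w. w \<in> Ar C
      \<Longrightarrow> cell2 (farr F w \<odot> comp1 \<alpha> (src C w)) (comp1 \<alpha> (tgt C w) \<odot> farr G w) (cell \<alpha> w)"
    and mono: "\<And>w. w \<in> Ar C \<Longrightarrow> jointly_monic (comp1 \<alpha> (tgt C w) \<odot> farr G w)"
  shows "lax_transformation C G F \<alpha>"
proof -
  interpret category C by fact
  have G_comp: "cell2 (farr G g \<odot> farr G f) (farr G (cmp C g f)) (fcmp G g f)"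
    and F_comp: "cell2 (farr F g \<odot> farr F f) (farr F (cmp C g f)) (fcmp F g f)"
    if "f \<in> Ar C" "g \<in> Ar C" "tgt C f = src C g" for f g
    using G F that unfolding lax_functor_def by blast+
  have G_unit: "cell2 (id_span (fobj G c)) (farr G (idn C c)) (funit G c)"
    and F_unit: "cell2 (id_span (fobj F c)) (farr F (idn C c)) (funit F c)"
    if "c \<in> Ob C" for c
    using G F that unfolding lax_functor_def by blast+
  have "agree_on (apex (id_span (fobj F c) \<odot> comp1 \<alpha> c))
      (cell \<alpha> (idn C c) \<circ> (funit F c \<star> id))
      ((id \<star> funit G c) \<circ> runit_inv (comp1 \<alpha> c) \<circ> lunit)" if c: "c \<in> Ob C" for c
  proof (rule cell2_agree_on)
    show "jointly_monic (comp1 \<alpha> c \<odot> farr G (idn C c))"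
      using mono[of "idn C c"] c by (simp add: idn_in tgt_idn)
    have "cell2 (farr F (idn C c) \<odot> comp1 \<alpha> c) (comp1 \<alpha> c \<odot> farr G (idn C c)) (cell \<alpha> (idn C c))"
      using cell[of "idn C c"] c by (simp add: idn_in src_idn tgt_idn)
    then show "cell2 (id_span (fobj F c) \<odot> comp1 \<alpha> c) (comp1 \<alpha> c \<odot> farr G (idn C c))
        (cell \<alpha> (idn C c) \<circ> (funit F c \<star> id))"
      using c by (blast intro: cell2_comp cell2_hcomp cell2_id F_unit)
    show "cell2 (id_span (fobj F c) \<odot> comp1 \<alpha> c) (comp1 \<alpha> c \<odot> farr G (idn C c))
        ((id \<star> funit G c) \<circ> runit_inv (comp1 \<alpha> c) \<circ> lunit)"
      using c by (blast intro: cell2_comp cell2_hcomp cell2_id G_unit cell2_runit_inv cell2_lunit span)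
  qed
  moreover have "agree_on (apex ((farr F g \<odot> farr F f) \<odot> comp1 \<alpha> (src C f)))
      (cell \<alpha> (cmp C g f) \<circ> (fcmp F g f \<star> id))
      ((id \<star> fcmp G g f) \<circ> assoc \<circ> (cell \<alpha> g \<star> id) \<circ> assoc_inv \<circ> (id \<star> cell \<alpha> f) \<circ> assoc)"
    if fg: "f \<in> Ar C" "g \<in> Ar C" "tgt C f = src C g" for f g
  proof (rule cell2_agree_on)
    show "jointly_monic (comp1 \<alpha> (tgt C g) \<odot> farr G (cmp C g f))"
      using mono[of "cmp C g f"] fg by (simp add: cmp_in tgt_cmp)
    have "cell2 (farr F (cmp C g f) \<odot> comp1 \<alpha> (src C f)) (comp1 \<alpha> (tgt C g) \<odot> farr G (cmp C g f))
        (cell \<alpha> (cmp C g f))"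
      using cell[of "cmp C g f"] fg by (simp add: cmp_in src_cmp tgt_cmp)
    then show "cell2 ((farr F g \<odot> farr F f) \<odot> comp1 \<alpha> (src C f))
        (comp1 \<alpha> (tgt C g) \<odot> farr G (cmp C g f)) (cell \<alpha> (cmp C g f) \<circ> (fcmp F g f \<star> id))"
      using fg by (blast intro: cell2_comp cell2_hcomp cell2_id F_comp)
    have "cell2 (farr F f \<odot> comp1 \<alpha> (src C f)) (comp1 \<alpha> (src C g) \<odot> farr G f) (cell \<alpha> f)"
      using cell[of f] fg by simp
    note cell_f = cell2_hcomp[OF cell2_id this]
      and cell_g = cell2_hcomp[OF cell[OF fg(2)] cell2_id]
    show "cell2 ((farr F g \<odot> farr F f) \<odot> comp1 \<alpha> (src C f))
        (comp1 \<alpha> (tgt C g) \<odot> farr G (cmp C g f))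
        ((id \<star> fcmp G g f) \<circ> assoc \<circ> (cell \<alpha> g \<star> id) \<circ> assoc_inv \<circ> (id \<star> cell \<alpha> f) \<circ> assoc)"
      \<comment> \<open>Read from the last fact to the first, the chain runs
        \<open>(F g \<odot> F f) \<odot> \<alpha>\<^sub>c\<close> \<Rightarrow>
        \<open>F g \<odot> (F f \<odot> \<alpha>\<^sub>c)\<close> \<Rightarrow>
        \<open>F g \<odot> (\<alpha>\<^sub>d \<odot> G f)\<close> \<Rightarrow>
        \<open>(F g \<odot> \<alpha>\<^sub>d) \<odot> G f\<close> \<Rightarrow>
        \<open>(\<alpha>\<^sub>e \<odot> G g) \<odot> G f\<close> \<Rightarrow>
        \<open>\<alpha>\<^sub>e \<odot> (G g \<odot> G f)\<close> \<Rightarrow>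
        \<open>\<alpha>\<^sub>e \<odot> G (g f)\<close>.\<close>
      by (rule cell2_comp[OF cell2_comp[OF cell2_comp[OF cell2_comp[OF cell2_comp[OF
          cell2_hcomp[OF cell2_id G_comp[OF fg]] cell2_assoc] cell_g] cell2_assoc_inv] cell_f]
          cell2_assoc])
  qed
  ultimately show ?thesis
    unfolding lax_transformation_def using G F span cell by blast
qed

text \<open>Up to associators the cell is
  \<open>F w \<odot> \<beta>\<^sub>c \<odot> \<alpha>\<^sub>c\<close> \<Rightarrow>
  \<open>\<beta>\<^sub>d \<odot> H w \<odot> \<alpha>\<^sub>c\<close> \<Rightarrow>
  \<open>\<beta>\<^sub>d \<odot> \<alpha>\<^sub>d \<odot> G w\<close>. Coherence of the pasted
  transformation is not derived from that of its factors; it comes from joint monicity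
  again.\<close>

lemma cell2_paste:
  assumes "cell2 (farr F w \<odot> comp1 \<beta> c) (comp1 \<beta> d \<odot> farr H w) (cell \<beta> w)"
    and "cell2 (farr H w \<odot> comp1 \<alpha> c) (comp1 \<alpha> d \<odot> farr G w) (cell \<alpha> w)"
  shows "cell2 (farr F w \<odot> comp1 (paste \<beta> \<alpha>) c) (comp1 (paste \<beta> \<alpha>) d \<odot> farr G w)
    (cell (paste \<beta> \<alpha>) w)"
  unfolding paste_def lax_trans.select_convs
  by (rule cell2_comp[OF cell2_comp[OF cell2_comp[OF cell2_comp[OF
      cell2_assoc_inv cell2_hcomp[OF cell2_id assms(2)]] cell2_assoc]
      cell2_hcomp[OF assms(1) cell2_id]] cell2_assoc_inv])

section \<open>Strict functors into Rel and Set, and the inclusion into Span(Set)\<close>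

definition is_rel_functor :: "('o, 'm) cat \<Rightarrow> ('o, 'm, 'a) rel_functor \<Rightarrow> bool" where
  "is_rel_functor C G \<longleftrightarrow>
     (\<forall>f\<in>Ar C. rarr G f \<subseteq> robj G (src C f) \<times> robj G (tgt C f)) \<and>
     (\<forall>c\<in>Ob C. rarr G (idn C c) = Id_on (robj G c)) \<and>
     (\<forall>f\<in>Ar C. \<forall>g\<in>Ar C. tgt C f = src C g \<longrightarrow> rarr G (cmp C g f) = rarr G f O rarr G g)"

lemma Im_cell2_mono: "cell2 S T h \<Longrightarrow> Im S \<subseteq> Im T"
  by (force simp: cell2_def Im_def)

text \<open>Each of the two inverse cells gives one inclusion. This is where invertibility of the
  comparison cells of a pseudofunctor enters: a comparison cell alone would make its image only
  lax.\<close>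

lemma Im_iso_cell2: "iso_cell2 S T h \<Longrightarrow> Im S = Im T"
  unfolding iso_cell2_def inverse_cells_def by (metis Im_cell2_mono subset_antisym)

lemma Im_id_span: "Im (id_span A) = Id_on A"
  by (auto simp: Im_def id_span_def)

lemma Im_span_comp: "Im (T \<odot> S) = Im S O Im T"
  by (force simp: Im_def span_comp_def)

lemma is_rel_functor_Im_after:
  assumes "pseudofunctor C F"
  shows "is_rel_functor C (Im_after F)"
proof -
  have "Im (farr F f) \<subseteq> fobj F (src C f) \<times> fobj F (tgt C f)" if "f \<in> Ar C" for f
    using assms that by (simp add: pseudofunctor_def lax_functor_def is_span_Im)
  moreover have "Im (farr F (idn C c)) = Id_on (fobj F c)" if "c \<in> Ob C" for c
    using assms that Im_iso_cell2 unfolding pseudofunctor_def by (metis Im_id_span)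
  moreover have "Im (farr F (cmp C g f)) = Im (farr F f) O Im (farr F g)"
    if "f \<in> Ar C" "g \<in> Ar C" "tgt C f = src C g" for f g
    using assms that Im_iso_cell2 unfolding pseudofunctor_def by (metis Im_span_comp)
  ultimately show ?thesis
    by (simp add: is_rel_functor_def Im_after_def)
qed

lemma is_set_functor_R_after: "is_rel_functor C G \<Longrightarrow> is_set_functor C (R_after G)"
  unfolding is_rel_functor_def is_set_functor_def R_after_def R_arr_def agree_on_def
  by (fastforce simp: Id_on_iff)

lemma graph_relcomp: "f \<in> A \<rightarrow> B \<Longrightarrow> graph A f O graph B g = graph A (g \<circ> f)"
  by (fastforce simp: graph_def)

lemma graph_cong: "agree_on A f g \<Longrightarrow> graph A f = graph A g"
  by (auto simp: graph_def agree_on_def)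

lemma graph_id: "graph A id = Id_on A"
  by (auto simp: graph_def)

text \<open>The functor laws of \<open>D\<close> hold only up to \<open>agree_on\<close>. A graph
  records the values on the domain alone, so they become equalities of relations.\<close>

lemma is_rel_functor_J_after:
  assumes "category C" "is_set_functor C D"
  shows "is_rel_functor C (J_after C D)"
proof -
  interpret category C by fact
  have "graph (sobj D (src C f)) (sarr D f) \<subseteq> sobj D (src C f) \<times> sobj D (tgt C f)"
    if "f \<in> Ar C" for f
    using assms(2) that by (auto simp: is_set_functor_def graph_def)
  moreover have "graph (sobj D c) (sarr D (idn C c)) = Id_on (sobj D c)" if "c \<in> Ob C" for c
    using assms(2) that graph_cong unfolding is_set_functor_def by (metis graph_id)
  moreover have "graph (sobj D (src C f)) (sarr D (cmp C g f))
      = graph (sobj D (src C f)) (sarr D f) O graph (sobj D (src C g)) (sarr D g)"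
    if "f \<in> Ar C" "g \<in> Ar C" "tgt C f = src C g" for f g
    using assms(2) that graph_cong graph_relcomp unfolding is_set_functor_def by metis
  ultimately show ?thesis
    by (simp add: is_rel_functor_def J_after_def src_idn src_cmp)
qed

text \<open>All arrows are sent to spans of relations, which are jointly monic, so only the
  comparison cells have to be exhibited.\<close>

lemma lax_functor_incl_after:
  assumes "category C" "is_rel_functor C G"
  shows "lax_functor C (incl_after G)"
proof (rule lax_functorI)
  fix c
  assume "c \<in> Ob C"
  then show "cell2 (id_span (fobj (incl_after G) c)) (farr (incl_after G) (idn C c))
      (funit (incl_after G) c)"
    using assms(2)
    by (auto simp: is_rel_functor_def incl_after_def cell2_def id_span_def incl_def incl_unit_def)
qed (use assms in \<open>auto simp: is_rel_functor_def incl_after_def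
  intro: is_span_incl jointly_monic_incl cell2_incl_comp\<close>)

section \<open>The unit and counit simulations and their pasting\<close>

lemma lax_transformation_eta_whisker:
  assumes "category C" "pseudofunctor C F"
  shows "lax_transformation C (incl_after (Im_after F)) F (eta_whisker F)"
proof (rule lax_transformationI)
  show F: "lax_functor C F"
    using assms(2) by (simp add: pseudofunctor_def)
  show "lax_functor C (incl_after (Im_after F))"
    by (rule lax_functor_incl_after[OF assms(1) is_rel_functor_Im_after[OF assms(2)]])
  fix w
  assume "w \<in> Ar C"
  then have span: "is_span (fobj F (src C w)) (fobj F (tgt C w)) (farr F w)"
    using F by (simp add: lax_functor_def)
  show "cell2 (farr F w \<odot> comp1 (eta_whisker F) (src C w))
      (comp1 (eta_whisker F) (tgt C w) \<odot> farr (incl_after (Im_after F)) w) (cell (eta_whisker F) w)"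
    unfolding eta_whisker_def incl_after_def Im_after_def lax_trans.select_convs
      span_functor.select_convs rel_functor.select_convs
    \<comment> \<open>The unitors on either side strip the identity 1-cell off the source and add
      one to the target; between them stands the unit at \<open>farr F w\<close>.\<close>
    by (rule cell2_comp[OF cell2_comp[OF cell2_lunit_inv[OF is_span_incl[OF is_span_Im[OF span]]]
        eta_universal(1)] cell2_runit[OF span]])
  show "jointly_monic (comp1 (eta_whisker F) (tgt C w) \<odot> farr (incl_after (Im_after F)) w)"
    by (simp add: eta_whisker_def incl_after_def jointly_monic_id_span_comp jointly_monic_incl)
qed (simp_all add: assms(1) eta_whisker_def incl_after_def Im_after_def is_span_id_span)

lemma lax_transformation_eps_whisker:
  assumes "category C" "is_rel_functor C G"
  shows "lax_transformation C (incl_after (J_after C (R_after G))) (incl_after G) (eps_whisker C G)"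
proof (rule lax_transformationI)
  show "lax_functor C (incl_after G)" "lax_functor C (incl_after (J_after C (R_after G)))"
    using assms
    by (auto intro: lax_functor_incl_after is_rel_functor_J_after is_set_functor_R_after)
  fix w
  assume "w \<in> Ar C"
  then have "rarr G w \<subseteq> robj G (src C w) \<times> robj G (tgt C w)"
    using assms(2) by (simp add: is_rel_functor_def)
  \<comment> \<open>Naturality of the counit equates the target of the comparison cell
    \<open>incl_comp\<close> with the source of the inverse one, so that the two can be composed.
    Containment of \<open>rarr G w\<close> in the product ensures that direct images lie in the
    powerset of the target object.\<close>
  note nat = eps_natural[OF this]
  show "cell2 (farr (incl_after G) w \<odot> comp1 (eps_whisker C G) (src C w))
      (comp1 (eps_whisker C G) (tgt C w) \<odot> farr (incl_after (J_after C (R_after G))) w)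
      (cell (eps_whisker C G) w)"
    unfolding eps_whisker_def incl_after_def J_after_def R_after_def lax_trans.select_convs
      span_functor.select_convs rel_functor.select_convs set_functor.select_convs
    using cell2_incl_comp[of "rarr G w" "eps (robj G (src C w))"] incl_comp_inverse_cells
    unfolding inverse_cells_def nat by (blast intro: cell2_comp)
  show "jointly_monic
      (comp1 (eps_whisker C G) (tgt C w) \<odot> farr (incl_after (J_after C (R_after G))) w)"
    by (simp add: eps_whisker_def incl_after_def J_after_def jointly_monic_comp_graph
        jointly_monic_incl)
next
  fix c
  show "is_span (fobj (incl_after (J_after C (R_after G))) c) (fobj (incl_after G) c)
      (comp1 (eps_whisker C G) c)"
    by (auto simp: eps_whisker_def incl_after_def J_after_def R_after_def eps_def
        intro: is_span_incl)
qed (fact assms(1))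

theorem proposition4p9:
  fixes C :: "('o, 'm) cat"
    and F :: "('o, 'm, 'a, 's) span_functor"
  assumes "category C"
    and "pseudofunctor C F"
  shows "is_set_functor C (Det F)
    \<and> simulation C F (incl_after (Im_after F)) (eta_whisker F)
    \<and> simulation C (incl_after (Im_after F)) (incl_after (J_after C (Det F)))
        (eps_whisker C (Im_after F))
    \<and> simulation C F (incl_after (J_after C (Det F)))
        (paste (eta_whisker F) (eps_whisker C (Im_after F)))"
proof -
  let ?\<beta> = "eta_whisker F" and ?\<alpha> = "eps_whisker C (Im_after F)"
  have rel: "is_rel_functor C (Im_after F)"
    by (rule is_rel_functor_Im_after[OF assms(2)])
  have eta: "lax_transformation C (incl_after (Im_after F)) F ?\<beta>"
    by (rule lax_transformation_eta_whisker[OF assms])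
  have eps: "lax_transformation C (incl_after (J_after C (Det F))) (incl_after (Im_after F)) ?\<alpha>"
    unfolding Det_def by (rule lax_transformation_eps_whisker[OF assms(1) rel])
  have "lax_transformation C (incl_after (J_after C (Det F))) F (paste ?\<beta> ?\<alpha>)"
  proof (rule lax_transformationI)
    fix w
    assume "w \<in> Ar C"
    then show "cell2 (farr F w \<odot> comp1 (paste ?\<beta> ?\<alpha>) (src C w))
        (comp1 (paste ?\<beta> ?\<alpha>) (tgt C w) \<odot> farr (incl_after (J_after C (Det F))) w)
        (cell (paste ?\<beta> ?\<alpha>) w)"
      using eta eps unfolding lax_transformation_def by (blast intro: cell2_paste)
    \<comment> \<open>The span is an identity after the membership relation after the graph of the
      determinized transition. The membership relation is jointly monic, and neither composing with
      the identity nor precomposing with a graph destroys this.\<close>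
    show "jointly_monic
        (comp1 (paste ?\<beta> ?\<alpha>) (tgt C w) \<odot> farr (incl_after (J_after C (Det F))) w)"
      by (simp add: paste_def eta_whisker_def eps_whisker_def incl_after_def J_after_def
          jointly_monic_comp_graph jointly_monic_id_span_comp jointly_monic_incl)
  next
    fix c
    assume "c \<in> Ob C"
    then show "is_span (fobj (incl_after (J_after C (Det F))) c) (fobj F c)
        (comp1 (paste ?\<beta> ?\<alpha>) c)"
      using eta eps unfolding lax_transformation_def paste_def lax_trans.select_convs
      by (blast intro: is_span_span_comp)
  qed (use assms eta eps in \<open>simp_all add: lax_transformation_def\<close>)
  then show ?thesis
    using eta eps is_set_functor_R_after[OF rel] by (simp add: simulation_def Det_def)
qed

end
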